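(* For any finite connected non-complete graph $G$ with at least one edge, there exists a Grundy dominating sequence $S$ of $G$ such that the subgraph of $G$ induced by the set $\widehat{S}$ of vertices of $S$ contains no isolated vertices.
   Context: For a graph $G$, a sequence of vertices $S=(v_1,\dots,v_k)$ is a legal sequence if for every $i\in[k]$, $N[v_i]\setminus\bigcup_{j=1}^{i-1}N[v_j]\neq\emptyset$ ($N[v]$ the closed neighborhood). A Grundy dominating sequence is a legal sequence of maximum length, and $\widehat{S}=\{v_1,\dots,v_k\}$ denotes the set of its vertices. *)

theory Defs
  imports "Graph_Theory.Kuratowski"
begin

text \<open>Undirected simple finite graphs are the locale \<^locale>\<open>graph\<close>: finite, loop-free,
  symmetric digraphs without parallel arcs. The adjacency relation is \<open>u \<rightarrow>\<^bsub>G\<^esub> v\<close>.\<close>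

definition closed_nbhd :: "('a, 'b) pre_digraph \<Rightarrow> 'a \<Rightarrow> 'a set" where
  "closed_nbhd G v = insert v {u. v \<rightarrow>\<^bsub>G\<^esub> u}"

definition legal_sequence :: "('a, 'b) pre_digraph \<Rightarrow> 'a list \<Rightarrow> bool" where
  "legal_sequence G S \<longleftrightarrow> set S \<subseteq> verts G \<and>
     (\<forall>i < length S. closed_nbhd G (S ! i) - (\<Union>j<i. closed_nbhd G (S ! j)) \<noteq> {})"

definition grundy_dominating_sequence :: "('a, 'b) pre_digraph \<Rightarrow> 'a list \<Rightarrow> bool" where
  "grundy_dominating_sequence G S \<longleftrightarrow> legal_sequence G S \<and>
     (\<forall>T. legal_sequence G T \<longrightarrow> length T \<le> length S)"

definition complete_graph :: "('a, 'b) pre_digraph \<Rightarrow> bool" where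
  "complete_graph G \<longleftrightarrow> (\<exists>n. complete_digraph n G)"

definition isolated_vertex :: "('a, 'b) pre_digraph \<Rightarrow> 'a \<Rightarrow> bool" where
  "isolated_vertex G v \<longleftrightarrow> v \<in> verts G \<and> \<not> (\<exists>u \<in> verts G. v \<rightarrow>\<^bsub>G\<^esub> u)"

end

theory Submission
  imports Defs
begin

text \<open>Among all Grundy dominating sequences take one whose set induces the fewest isolated
  vertices, and suppose that \<open>v\<close> is one of these. As no other vertex of the sequence dominates \<open>v\<close>,
  it can be moved to the end and then exchanged for any neighbour \<open>w\<close>, which still footprints \<open>v\<close>.
  By minimality \<open>w\<close> is again isolated, so the exchange can be repeated along any walk, and by
  connectedness the last vertex can be exchanged for every vertex of the graph. A vertex occurring
  earlier in the sequence cannot be repeated, so the sequence has length one. But two distinct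
  non-adjacent vertices form a legal sequence of length two.\<close>

lemma legal_sequence_Nil [simp]: "legal_sequence G []"
  by (simp add: legal_sequence_def)

text \<open>Trades the positional definition for a recursion on the last vertex, the form needed for
  reverse induction and for exchanging that vertex.\<close>

lemma legal_sequence_snoc:
  "legal_sequence G (S @ [x]) \<longleftrightarrow>
     legal_sequence G S \<and> x \<in> verts G \<and> closed_nbhd G x - (\<Union>y\<in>set S. closed_nbhd G y) \<noteq> {}"
proof -
  have "(\<Union>j<length S. closed_nbhd G (S ! j)) = (\<Union>y\<in>set S. closed_nbhd G y)"
    by (fastforce simp: set_conv_nth)
  moreover have "(\<Union>j<i. closed_nbhd G ((S @ [x]) ! j)) = (\<Union>j<i. closed_nbhd G (S ! j))"
    if "i \<le> length S" for i
    using that by (intro SUP_cong) (auto simp: nth_append)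
  ultimately show ?thesis
    by (auto simp: legal_sequence_def less_Suc_eq nth_append)
qed

text \<open>Deleting \<open>v\<close> only shrinks the union that each later closed neighbourhood
  must escape.\<close>

lemma legal_sequence_remove:
  "legal_sequence G (A @ v # B) \<Longrightarrow> legal_sequence G (A @ B)"
proof (induction B rule: rev_induct)
  case Nil
  then show ?case by (simp add: legal_sequence_snoc)
next
  case (snoc x B)
  from snoc.prems have "legal_sequence G ((A @ v # B) @ [x])" by simp
  then have "legal_sequence G ((A @ B) @ [x])"
    unfolding legal_sequence_snoc using snoc.IH by auto
  then show ?case by simp
qed

text \<open>A second occurrence of a vertex would have nothing left to footprint.\<close>

lemma legal_sequence_distinct: "legal_sequence G S \<Longrightarrow> distinct S"
  by (induction S rule: rev_induct) (auto simp: legal_sequence_snoc)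

lemma isolated_vertex_induce_subgraph:
  "isolated_vertex (G \<restriction> U) v \<longleftrightarrow> v \<in> U \<and> (\<forall>u\<in>U. \<not> v \<rightarrow>\<^bsub>G\<^esub> u)"
  by (fastforce simp: isolated_vertex_def arcs_ends_conv)

text \<open>The empty sequence is legal, and distinctness bounds the length of legal sequences by
  the number of vertices.\<close>

lemma (in fin_digraph) grundy_dominating_sequence_exists:
  "\<exists>S. grundy_dominating_sequence G S"
proof -
  have "length S \<le> card (verts G)" if "legal_sequence G S" for S
    using that legal_sequence_distinct[OF that] card_mono[OF finite_verts, of "set S"]
    by (auto simp: legal_sequence_def distinct_card)
  then show ?thesis
    using ex_has_greatest_nat[of "legal_sequence G" "[]" length "Suc (card (verts G))"]
    by (auto simp: grundy_dominating_sequence_def less_Suc_eq_le)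
qed

lemma (in graph) complete_graphI:
  assumes "\<And>u v. u \<in> verts G \<Longrightarrow> v \<in> verts G \<Longrightarrow> u \<noteq> v \<Longrightarrow> u \<rightarrow>\<^bsub>G\<^esub> v"
  shows "complete_graph G"
proof -
  have "arcs_ends G = {(u, v). (u, v) \<in> verts G \<times> verts G \<and> u \<noteq> v}"
    by (auto intro: assms dest: adj_in_verts adj_not_same)
  then show ?thesis
    using graph_axioms by (auto simp: complete_graph_def complete_digraph_def)
qed

text \<open>By symmetry \<open>w\<close> dominates \<open>v\<close>, which \<open>R\<close> leaves
  undominated, so \<open>w\<close> footprints \<open>v\<close>; the length, hence maximality, is
  unchanged.\<close>

lemma (in graph) grundy_exchange_last:
  assumes "grundy_dominating_sequence G (R @ [v])"
    and "v \<notin> (\<Union>y\<in>set R. closed_nbhd G y)"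
    and "v \<rightarrow>\<^bsub>G\<^esub> w"
  shows "grundy_dominating_sequence G (R @ [w])"
proof -
  have "v \<in> closed_nbhd G w"
    using assms(3) by (simp add: closed_nbhd_def graph_symmetric)
  moreover have "w \<in> verts G"
    using assms(3) adj_in_verts by blast
  ultimately have "legal_sequence G (R @ [w])"
    using assms(1,2) by (auto simp: grundy_dominating_sequence_def legal_sequence_snoc)
  then show ?thesis
    using assms(1) by (simp add: grundy_dominating_sequence_def)
qed

theorem theorem5p2:
  fixes G :: "('a, 'b) pre_digraph"
  assumes "graph G"
    and "connected G"
    and "\<not> complete_graph G"
    and "arcs G \<noteq> {}"
  shows "\<exists>S. grundy_dominating_sequence G S \<and>
    \<not> (\<exists>v. isolated_vertex (G \<restriction> set S) v)"
proof -
  interpret graph G by fact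
  define iso where "iso S = {v. isolated_vertex (G \<restriction> set S) v}" for S
  have finite_iso: "finite (iso S)" for S
    by (rule finite_subset[of _ "set S"]) (auto simp: iso_def isolated_vertex_induce_subgraph)
  obtain S where S: "grundy_dominating_sequence G S"
    and min: "\<And>T. grundy_dominating_sequence G T \<Longrightarrow> card (iso S) \<le> card (iso T)"
    using grundy_dominating_sequence_exists
      ex_has_least_nat[of "grundy_dominating_sequence G" _ "\<lambda>S. card (iso S)"] by blast
  have "\<not> isolated_vertex (G \<restriction> set S) v" for v
  proof
    assume v: "isolated_vertex (G \<restriction> set S) v"
    then obtain A B where AB: "S = A @ v # B"
      by (metis isolated_vertex_induce_subgraph split_list)
    define R where "R = A @ B"
    have set_S: "set S = insert v (set R)"
      by (auto simp: AB R_def)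
    have legal_S: "legal_sequence G S"
      using S by (simp add: grundy_dominating_sequence_def)
    have legal_R: "legal_sequence G R"
      using legal_S legal_sequence_remove by (auto simp: AB R_def)
    have "v \<notin> set R"
      using legal_sequence_distinct[OF legal_S] by (auto simp: AB R_def)
    then have v_undominated: "v \<notin> (\<Union>y\<in>set R. closed_nbhd G y)"
      using v by (auto simp: isolated_vertex_induce_subgraph closed_nbhd_def set_S
          dest: graph_symmetric)
    have "v \<in> verts G"
      using legal_S by (auto simp: legal_sequence_def set_S)
    then have "legal_sequence G (R @ [v])"
      using legal_R v_undominated by (auto simp: legal_sequence_snoc closed_nbhd_def)
    then have grundy_v: "grundy_dominating_sequence G (R @ [v])"
      using S by (simp add: grundy_dominating_sequence_def AB R_def)
    have undominated: "w \<notin> (\<Union>y\<in>set R. closed_nbhd G y)"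
      if grundy_w: "grundy_dominating_sequence G (R @ [w])" for w
    proof
      assume w: "w \<in> (\<Union>y\<in>set R. closed_nbhd G y)"
      have "w \<notin> set R"
        using grundy_w legal_sequence_distinct[of G "R @ [w]"]
        by (auto simp: grundy_dominating_sequence_def)
      then obtain y where "y \<in> set R" "w \<rightarrow>\<^bsub>G\<^esub> y"
        using w by (auto simp: closed_nbhd_def dest: graph_symmetric)
      \<comment> \<open>The neighbour \<open>y\<close> keeps \<open>w\<close> from being isolated. A
        vertex of \<open>R\<close> isolated in the new set is also not adjacent to \<open>v\<close>,
        so it was isolated in \<open>S\<close>; and \<open>v\<close> itself is gone, since
        \<open>w\<close> is dominated by \<open>R\<close> and \<open>v\<close> is not.\<close>
      then have "iso (R @ [w]) \<subseteq> iso S - {v}"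
        using v_undominated
        by (auto simp: iso_def isolated_vertex_induce_subgraph closed_nbhd_def set_S)
      then have "iso (R @ [w]) \<subset> iso S"
        using v by (auto simp: iso_def)
      then have "card (iso (R @ [w])) < card (iso S)"
        by (rule psubset_card_mono[OF finite_iso])
      then show False
        using min[OF grundy_w] by simp
    qed
    have exchange: "grundy_dominating_sequence G (R @ [x])" if "x \<in> verts G" for x
    proof -
      have "v \<rightarrow>\<^sup>*\<^bsub>G\<^esub> x"
        using symmetric_connected_imp_strongly_connected[OF sym_arcs assms(2)] \<open>v \<in> verts G\<close> that
        by blast
      then show ?thesis
      proof (induction rule: reachable_induct)
        case base
        show ?case by (rule grundy_v)
      next
        case (step y z)
        \<comment> \<open>The induction hypothesis makes \<open>R @ [y]\<close> maximum, so
          \<open>undominated\<close> supplies the premise for exchanging \<open>y\<close> with its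
          neighbour \<open>z\<close>.\<close>
        then show ?case
          using grundy_exchange_last undominated by metis
      qed
    qed
    have "x \<notin> set R" for x
    proof
      assume "x \<in> set R"
      moreover from this have "x \<in> verts G"
        using legal_R by (auto simp: legal_sequence_def)
      \<comment> \<open>The exchange would put \<open>x\<close> last, yet \<open>x\<close> already
        dominates itself from within \<open>R\<close>.\<close>
      ultimately show False
        using undominated[OF exchange] by (auto simp: closed_nbhd_def)
    qed
    then have "R = []"
      using list.set_sel(1) by metis
    then have length_le: "length T \<le> 1" if "legal_sequence G T" for T
      using grundy_v that by (auto simp: grundy_dominating_sequence_def)
    obtain a b where ab: "a \<in> verts G" "b \<in> verts G" "a \<noteq> b" "\<not> a \<rightarrow>\<^bsub>G\<^esub> b"
      using assms(3) complete_graphI by blast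
    \<comment> \<open>Here \<open>b\<close> footprints itself. The explicit appends let
      \<open>legal_sequence_snoc\<close> unfold twice.\<close>
    then have "legal_sequence G (([] @ [a]) @ [b])"
      unfolding legal_sequence_snoc by (auto simp: closed_nbhd_def)
    then show False
      by (auto dest: length_le)
  qed
  then show ?thesis
    using S by blast
qed

end
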